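(* Let $H$ be a real Hilbert space and let $f, g \in \Gamma_0(H)$ be such that $\mathrm{dom}(f) \cap \mathrm{dom}(g) \neq \emptyset$. If $\partial(f+g) = \partial f + \partial g$ (equality of set-valued maps on $H$), then the decomposition formula $$\mathrm{prox}_{f+g} = \mathrm{prox}_f \circ \mathrm{prox}^f_g$$ holds true, where $\mathrm{prox}^f_g$ is the $f$-proximal operator of $g$. In other words, for every $x \in H$, we have $\mathrm{prox}_{f+g}(x) = \mathrm{prox}_f(z)$ for all $z \in \mathrm{prox}^f_g(x)$.
   Context: $\Gamma_0(H)$ is the set of proper, lower semicontinuous, convex functions $H \to \mathbb{R} \cup \{+\infty\}$. For $g : H \to \mathbb{R}\cup\{+\infty\}$, $\mathrm{dom}(g) = \{x \in H : g(x) < +\infty\}$. For $g \in \Gamma_0(H)$, the subdifferential is the set-valued map $\partial g(x) = \{ y \in H : \langle y, z-x\rangle \le g(z)-g(x)\ \forall z \in H\}$. Sums of set-valued maps are pointwise Minkowski sums (empty if one of the summands is empty). For a set-valued map $A : H \rightrightarrows H$, $A^{-1}(y) = \{x \in H : y \in A(x)\}$; $I$ is the identity operator. The proximal operator of $g \in \Gamma_0(H)$ is $\mathrm{prox}_g = (I+\partial g)^{-1}$, which is single-valued and defined everywhere on $H$; equivalently $\mathrm{prox}_g(x)$ is the unique minimizer of $g + \frac12\|\cdot - x\|^2$. The $f$-proximal operator of $g$ (for $f,g\in\Gamma_0(H)$) is the set-valued map $\mathrm{prox}^f_g : H \rightrightarrows H$ defined by $\mathrm{prox}^f_g = (I + \partial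 g \circ \mathrm{prox}_f)^{-1}$; that is, $y \in \mathrm{prox}^f_g(x)$ if and only if $x - y \in \partial g(\mathrm{prox}_f(y))$. The composition is that of set-valued maps: $(\mathrm{prox}_f \circ \mathrm{prox}^f_g)(x) = \{\mathrm{prox}_f(z) : z \in \mathrm{prox}^f_g(x)\}$, and the single-valued $\mathrm{prox}_{f+g}(x)$ is identified with the singleton $\{\mathrm{prox}_{f+g}(x)\}$. *)

theory Defs
  imports "HOL-Analysis.Analysis" "HOL-Library.Set_Algebras"
begin

text \<open>
  A real Hilbert space is a type of sort \<open>{real_inner, complete_space}\<close>. Functions into
  $\<real> \cup \{+\infty\}$ are \<open>ereal\<close>-valued functions that never take the value \<open>-\<infinity>\<close>.
\<close>

definition effective_domain :: "('a \<Rightarrow> ereal) \<Rightarrow> 'a set" where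
  "effective_domain g = {x. g x < \<infinity>}"

definition proper :: "('a \<Rightarrow> ereal) \<Rightarrow> bool" where
  "proper g \<longleftrightarrow> (\<forall>x. g x \<noteq> -\<infinity>) \<and> effective_domain g \<noteq> {}"

definition lower_semicontinuous :: "('a::topological_space \<Rightarrow> ereal) \<Rightarrow> bool" where
  "lower_semicontinuous g \<longleftrightarrow> (\<forall>x. g x \<le> Liminf (at x) g)"

definition ereal_convex :: "('a::real_vector \<Rightarrow> ereal) \<Rightarrow> bool" where
  "ereal_convex g \<longleftrightarrow> (\<forall>x y. \<forall>t::real. 0 < t \<and> t < 1 \<longrightarrow>
      g ((1 - t) *\<^sub>R x + t *\<^sub>R y) \<le> ereal (1 - t) * g x + ereal t * g y)"

definition Gamma0 :: "('a::{real_inner, complete_space} \<Rightarrow> ereal) set" where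
  "Gamma0 = {g. proper g \<and> lower_semicontinuous g \<and> ereal_convex g}"

text \<open>
  In \<open>ereal\<close>, \<open>\<infinity> - \<infinity> = \<infinity>\<close>. This is harmless for proper \<open>g\<close>: if \<open>g x = \<infinity>\<close>,
  any \<open>z\<close> in the effective domain gives \<open>g z - g x = -\<infinity>\<close>, so the
  subdifferential at \<open>x\<close> is empty.
\<close>

definition subdifferential :: "('a::real_inner \<Rightarrow> ereal) \<Rightarrow> 'a \<Rightarrow> 'a set" where
  "subdifferential g x = {y. \<forall>z. ereal (y \<bullet> (z - x)) \<le> g z - g x}"

text \<open>
  Set-valued maps are functions into sets. Sums of their values are the Minkowski sums of
  \<^theory>\<open>HOL-Library.Set_Algebras\<close>; the identity operator is \<open>\<lambda>x. {x}\<close>.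
\<close>

definition setmap_inverse :: "('a \<Rightarrow> 'b set) \<Rightarrow> 'b \<Rightarrow> 'a set" where
  "setmap_inverse A y = {x. y \<in> A x}"

definition setmap_comp :: "('b \<Rightarrow> 'c set) \<Rightarrow> ('a \<Rightarrow> 'b set) \<Rightarrow> 'a \<Rightarrow> 'c set" where
  "setmap_comp B A x = (\<Union>y\<in>A x. B y)"

definition setmap_of :: "('a \<Rightarrow> 'b) \<Rightarrow> 'a \<Rightarrow> 'b set" where
  "setmap_of h x = {h x}"

text \<open>
  The inverse of \<open>I + \<partial>g\<close> is single-valued and everywhere defined for \<open>g \<in> Gamma0\<close>
  (Moreau), so \<open>prox g\<close> is the function whose value is the unique element.
\<close>

definition prox :: "('a::{real_inner, complete_space} \<Rightarrow> ereal) \<Rightarrow> 'a \<Rightarrow> 'a" where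
  "prox g x = (THE p. p \<in> setmap_inverse (\<lambda>y. {y} + subdifferential g y) x)"

definition f_prox ::
  "('a::{real_inner, complete_space} \<Rightarrow> ereal) \<Rightarrow> ('a \<Rightarrow> ereal) \<Rightarrow> 'a \<Rightarrow> 'a set" where
  "f_prox f g =
     setmap_inverse (\<lambda>y. {y} + setmap_comp (subdifferential g) (setmap_of (prox f)) y)"

lemma mem_f_prox_iff: "y \<in> f_prox f g x \<longleftrightarrow> x - y \<in> subdifferential g (prox f y)"
proof
  assume "y \<in> f_prox f g x"
  then show "x - y \<in> subdifferential g (prox f y)"
    by (auto simp: f_prox_def setmap_inverse_def setmap_comp_def setmap_of_def set_plus_def)
next
  assume "x - y \<in> subdifferential g (prox f y)"
  moreover have "x = y + (x - y)" by simp
  ultimately show "y \<in> f_prox f g x"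
    unfolding f_prox_def setmap_inverse_def setmap_comp_def setmap_of_def set_plus_def by blast
qed

end

theory Submission
  imports Defs
begin

text \<open>
  Everything rests on Moreau's theorem: for \<open>h \<in> Gamma0\<close> the inclusion
  \<open>x - p \<in> \<partial>h(p)\<close> has exactly one solution \<open>p\<close>, namely \<open>prox h x\<close>. Granted this for
  \<open>f\<close> and for \<open>f + g\<close>, the decomposition formula only regroups a sum. If
  \<open>z \<in> f_prox f g x\<close> and \<open>p = prox f z\<close>, then \<open>z - p \<in> \<partial>f(p)\<close> and \<open>x - z \<in> \<partial>g(p)\<close>, which add
  up to \<open>x - p \<in> \<partial>f(p) + \<partial>g(p) \<subseteq> \<partial>(f + g)(p)\<close>, so \<open>p = prox (f + g) x\<close>. Conversely, if
  \<open>p = prox (f + g) x\<close>, the inclusion \<open>\<partial>(f + g)(p) \<subseteq> \<partial>f(p) + \<partial>g(p)\<close> splits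
  \<open>x - p = u + v\<close>, and \<open>z = p + u\<close> is a point of \<open>f_prox f g x\<close> with \<open>prox f z = p\<close>.

  Uniqueness in Moreau's theorem is monotonicity of the subdifferential
  (\<open>prox_inclusion_unique\<close>). For existence, \<open>p\<close> is found as the minimizer of
  \<open>h + \<parallel>\<cdot> - x\<parallel>\<^sup>2 / 2\<close>. This function is bounded below, since a convex function that is
  bounded below near one point decreases at most linearly
  (\<open>Gamma0_lower_bound\<close>); by the parallelogram law its minimizing sequences are
  Cauchy (\<open>midpoint_gap\<close>); and by lower semicontinuity their limit is a minimizer
  (\<open>prox_objective_attains_minimum\<close>). Comparing a minimizer with nearby points on
  segments yields the inclusion (\<open>minimizer_imp_prox_inclusion\<close>).
\<close>

section \<open>Lower semicontinuous and convex functions\<close>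

lemma proper_finite_value:
  assumes "proper h" and "x \<in> effective_domain h"
  obtains a where "h x = ereal a"
  using assms by (cases "h x") (auto simp: proper_def effective_domain_def)

text \<open>
  The limit inferior in the definition ignores the value at the point itself; adding
  that value changes nothing, and neighbourhoods of the point may be used instead.
\<close>

lemma lower_semicontinuous_eventually:
  assumes "lower_semicontinuous h" and "c < h x"
  shows "\<forall>\<^sub>F y in nhds x. c < h y"
  using assms by (auto simp: lower_semicontinuous_def le_Liminf_iff eventually_nhds_conv_at)

lemma lower_semicontinuous_limit_le:
  fixes h :: "'a::topological_space \<Rightarrow> ereal"
  assumes "lower_semicontinuous h" and "y \<longlonglongrightarrow> p" and "u \<longlonglongrightarrow> l"
    and "\<And>n::nat. h (y n) \<le> ereal (u n)"
  shows "h p \<le> ereal l"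
proof (rule ccontr)
  assume "\<not> h p \<le> ereal l"
  then obtain c where c: "ereal l < ereal c" "ereal c < h p"
    using ereal_dense2 by (metis not_le)
  have "\<forall>\<^sub>F n in sequentially. ereal c < h (y n)"
    using lower_semicontinuous_eventually[OF assms(1) c(2)] assms(2)
    by (auto simp: filterlim_iff)
  moreover have "\<forall>\<^sub>F n in sequentially. u n < c"
    using assms(3) c(1) by (intro order_tendstoD) auto
  ultimately have "\<forall>\<^sub>F n in sequentially. False"
  proof eventually_elim
    case (elim n)
    with assms(4)[of n] have "ereal c < ereal (u n)" by (metis less_le_trans)
    with elim show False by simp
  qed
  then show False by simp
qed

lemma ereal_convex_finite_values:
  assumes "ereal_convex h" and "proper h" and "h x = ereal a" and "h y = ereal b"
    and "0 < t" and "t < 1"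
  obtains c where "h ((1 - t) *\<^sub>R x + t *\<^sub>R y) = ereal c" and "c \<le> (1 - t) * a + t * b"
proof -
  have "h ((1 - t) *\<^sub>R x + t *\<^sub>R y) \<le> ereal ((1 - t) * a + t * b)"
    using assms unfolding ereal_convex_def by (metis plus_ereal.simps(1) times_ereal.simps(1))
  moreover have "h ((1 - t) *\<^sub>R x + t *\<^sub>R y) \<noteq> -\<infinity>"
    using assms(2) by (auto simp: proper_def)
  ultimately show thesis
    using that by (cases "h ((1 - t) *\<^sub>R x + t *\<^sub>R y)") auto
qed

lemma lower_semicontinuous_add:
  assumes f: "lower_semicontinuous f" "\<And>x. f x \<noteq> -\<infinity>"
    and g: "lower_semicontinuous g" "\<And>x. g x \<noteq> -\<infinity>"
  shows "lower_semicontinuous (\<lambda>x. f x + g x)"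
  unfolding lower_semicontinuous_def le_Liminf_iff
proof (intro allI impI)
  fix x c assume c: "c < f x + g x"
  show "\<forall>\<^sub>F y in at x. c < f y + g y"
  proof (cases c)
    case (real r)
    \<comment> \<open>Split the bound \<open>r\<close> on the sum into bounds on the summands.\<close>
    have "\<exists>a b. ereal a < f x \<and> ereal b < g x \<and> r \<le> a + b"
    proof (cases "f x"; cases "g x")
      fix s t assume "f x = ereal s" "g x = ereal t"
      with c real show ?thesis
        by (intro exI[of _ "s - (s + t - r) / 2"] exI[of _ "t - (s + t - r) / 2"])
          (auto simp: field_simps)
    next
      fix s assume "f x = ereal s" "g x = \<infinity>"
      then show ?thesis by (intro exI[of _ "s - 1"] exI[of _ "r - s + 1"]) auto
    next
      fix t assume "f x = \<infinity>" "g x = ereal t"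
      then show ?thesis by (intro exI[of _ "r - t + 1"] exI[of _ "t - 1"]) auto
    next
      assume "f x = \<infinity>" "g x = \<infinity>"
      then show ?thesis by (intro exI[of _ r] exI[of _ 0]) auto
    qed (use f(2) g(2) in auto)
    then obtain a b where ab: "ereal a < f x" "ereal b < g x" "r \<le> a + b" by blast
    have "\<forall>\<^sub>F y in nhds x. c < f y + g y"
      using lower_semicontinuous_eventually[OF f(1) ab(1)]
        lower_semicontinuous_eventually[OF g(1) ab(2)]
    proof eventually_elim
      case (elim y)
      have "c \<le> ereal a + ereal b" using ab(3) real by simp
      also have "\<dots> < f y + g y" using elim by (cases "f y"; cases "g y") auto
      finally show ?case .
    qed
    then show ?thesis by (simp add: eventually_nhds_conv_at)
  next
    case MInf
    have "-\<infinity> < f y + g y" for y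
      using f(2)[of y] g(2)[of y] by (cases "f y"; cases "g y") auto
    with MInf show ?thesis by simp
  qed (use c in auto)
qed

lemma ereal_convex_add:
  fixes f g :: "'a::real_vector \<Rightarrow> ereal"
  assumes f: "ereal_convex f" "\<And>x. f x \<noteq> -\<infinity>" and g: "ereal_convex g" "\<And>x. g x \<noteq> -\<infinity>"
  shows "ereal_convex (\<lambda>x. f x + g x)"
  unfolding ereal_convex_def
proof (intro allI impI)
  fix x y :: 'a and t :: real assume t: "0 < t \<and> t < 1"
  let ?z = "(1 - t) *\<^sub>R x + t *\<^sub>R y"
  have "f ?z + g ?z \<le> (ereal (1 - t) * f x + ereal t * f y) + (ereal (1 - t) * g x + ereal t * g y)"
    using f(1) g(1) t by (intro add_mono) (auto simp: ereal_convex_def)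
  also have "\<dots> = ereal (1 - t) * (f x + g x) + ereal t * (f y + g y)"
    using f(2)[of x] f(2)[of y] g(2)[of x] g(2)[of y] t
    by (cases "f x"; cases "f y"; cases "g x"; cases "g y") (auto simp: algebra_simps)
  finally show "f ?z + g ?z \<le> \<dots>" .
qed

lemma Gamma0_add:
  assumes "f \<in> Gamma0" and "g \<in> Gamma0" and "effective_domain f \<inter> effective_domain g \<noteq> {}"
  shows "(\<lambda>x. f x + g x) \<in> Gamma0"
proof -
  have f: "f x \<noteq> -\<infinity>" and g: "g x \<noteq> -\<infinity>" for x
    using assms by (auto simp: Gamma0_def proper_def)
  have "f x + g x \<noteq> -\<infinity>" for x
    using f[of x] g[of x] by (cases "f x"; cases "g x") auto
  moreover have "effective_domain (\<lambda>x. f x + g x) \<noteq> {}"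
    using assms(3) by (auto simp: effective_domain_def)
  ultimately show ?thesis
    using assms f g lower_semicontinuous_add[of f g] ereal_convex_add[of f g]
    by (auto simp: Gamma0_def proper_def)
qed

section \<open>Existence of proximal points\<close>

text \<open>
  Lower semicontinuity bounds \<open>h\<close> from below on a ball of radius \<open>2d\<close> about \<open>y0\<close>. A point
  \<open>y\<close> outside is joined to \<open>y0\<close> by a segment that passes through a point at distance \<open>d\<close>, and
  convexity along this segment carries the bound over to \<open>y\<close> with a loss
  proportional to \<open>\<parallel>y - y0\<parallel>\<close>. This elementary bound replaces the affine minorant
  that a separation theorem would provide.
\<close>

lemma Gamma0_lower_bound:
  fixes h :: "'a::{real_inner, complete_space} \<Rightarrow> ereal"
  assumes "h \<in> Gamma0"
  obtains K c y0 where "0 \<le> K" and "\<forall>y. ereal (c - K * norm (y - y0)) \<le> h y"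
proof -
  have h: "proper h" "lower_semicontinuous h" "ereal_convex h"
    using assms by (auto simp: Gamma0_def)
  obtain y0 where y0: "y0 \<in> effective_domain h" using h(1) by (auto simp: proper_def)
  obtain a where a: "h y0 = ereal a" using proper_finite_value[OF h(1) y0] .
  have "ereal (a - 1) < h y0" using a by simp
  from lower_semicontinuous_eventually[OF h(2) this] obtain e where
    e: "0 < e" "\<And>y. dist y y0 < e \<Longrightarrow> ereal (a - 1) < h y"
    by (auto simp: eventually_nhds_metric)
  define d where "d = e / 2"
  have d: "0 < d" "d < e" using e by (auto simp: d_def)
  show thesis
  proof (rule that[of "1 / d" "a - 1" y0], goal_cases)
    case 2
    show ?case
    proof
      fix y
      show "ereal (a - 1 - 1 / d * norm (y - y0)) \<le> h y"
      proof (cases "norm (y - y0) < e")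
        case True
        have "ereal (a - 1 - 1 / d * norm (y - y0)) \<le> ereal (a - 1)" using d by simp
        also have "\<dots> \<le> h y" using e(2)[of y] True by (simp add: dist_norm less_imp_le)
        finally show ?thesis .
      next
        case far: False
        show ?thesis
        proof (cases "h y")
          case (real b)
          define t where "t = d / norm (y - y0)"
          have t: "0 < t" "t < 1"
            using far d by (auto simp: t_def zero_less_divide_iff divide_less_eq_1)
          obtain c where c: "h ((1 - t) *\<^sub>R y0 + t *\<^sub>R y) = ereal c" "c \<le> (1 - t) * a + t * b"
            using ereal_convex_finite_values[OF h(3,1) a real t] .
          have "(1 - t) *\<^sub>R y0 + t *\<^sub>R y - y0 = t *\<^sub>R (y - y0)" by (simp add: algebra_simps)
          then have "dist ((1 - t) *\<^sub>R y0 + t *\<^sub>R y) y0 = t * norm (y - y0)"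
            using t by (simp add: dist_norm)
          also have "\<dots> < e" using far d t by (auto simp: t_def)
          finally have "a - 1 < c" using e(2) c(1) by fastforce
          with c(2) have "t * (a - b) < 1" by (simp add: algebra_simps)
          then have "a - b < 1 / t" using t by (simp add: field_simps)
          moreover have "1 / t = 1 / d * norm (y - y0)" by (simp add: t_def)
          ultimately show ?thesis using real by simp
        qed (use h(1) in \<open>auto simp: proper_def\<close>)
      qed
    qed
  qed (use d in auto)
qed

text \<open>
  The quadratic term is uniformly convex by the parallelogram law. Hence near-minimizers
  \<open>y\<close>, \<open>z\<close> are close to each other: otherwise the value at their midpoint would
  fall below the lower bound \<open>m\<close>.
\<close>

lemma midpoint_gap:
  fixes h :: "'a::real_inner \<Rightarrow> ereal"
  assumes "ereal_convex h" and "proper h"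
    and m: "\<And>w c. h w = ereal c \<Longrightarrow> m \<le> c + (norm (w - x))\<^sup>2 / 2"
    and "h y = ereal a" and "h z = ereal b"
  shows "(norm (y - z))\<^sup>2 \<le>
    4 * ((a + (norm (y - x))\<^sup>2 / 2 - m) + (b + (norm (z - x))\<^sup>2 / 2 - m))"
proof -
  let ?w = "(1 - 1 / 2) *\<^sub>R y + (1 / 2 :: real) *\<^sub>R z"
  obtain c where c: "h ?w = ereal c" "c \<le> (1 - 1 / 2) * a + 1 / 2 * b"
    using ereal_convex_finite_values[OF assms(1,2,4,5), of "1 / 2"] by auto
  have w: "?w - x = (1 / 2) *\<^sub>R ((y - x) + (z - x))"
    by (simp add: algebra_simps flip: scaleR_add_left)
  have "(norm (?w - x))\<^sup>2 = (norm ((y - x) + (z - x)))\<^sup>2 / 4"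
    unfolding w by (simp add: power_divide)
  moreover have "(norm ((y - x) + (z - x)))\<^sup>2 + (norm (y - z))\<^sup>2
      = 2 * (norm (y - x))\<^sup>2 + 2 * (norm (z - x))\<^sup>2"
    by (simp add: power2_norm_eq_inner inner_simps algebra_simps inner_commute)
  ultimately show ?thesis
    using m[OF c(1)] c(2) by (simp add: field_simps)
qed

lemma prox_objective_attains_minimum:
  fixes h :: "'a::{real_inner, complete_space} \<Rightarrow> ereal" and x :: 'a
  assumes "h \<in> Gamma0"
  obtains p a where "h p = ereal a"
    and "\<And>y b. h y = ereal b \<Longrightarrow> a + (norm (p - x))\<^sup>2 / 2 \<le> b + (norm (y - x))\<^sup>2 / 2"
proof -
  have h: "proper h" "lower_semicontinuous h" "ereal_convex h"
    using assms by (auto simp: Gamma0_def)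
  define S where "S = {b + (norm (y - x))\<^sup>2 / 2 | y b. h y = ereal b}"
  obtain K c y0 where K: "0 \<le> K" "\<forall>y. ereal (c - K * norm (y - y0)) \<le> h y"
    using Gamma0_lower_bound[OF assms] .
  \<comment> \<open>The quadratic term dominates the linear loss; completing the square costs \<open>K\<^sup>2 / 2\<close>.\<close>
  have below: "c - K * norm (x - y0) - K\<^sup>2 / 2 \<le> b + (norm (y - x))\<^sup>2 / 2"
    if "h y = ereal b" for y b
  proof -
    have "norm (y - y0) \<le> norm (y - x) + norm (x - y0)"
      using norm_triangle_ineq[of "y - x" "x - y0"] by simp
    then have "K * norm (y - y0) \<le> K * norm (y - x) + K * norm (x - y0)"
      using K(1) by (metis distrib_left mult_left_mono)
    moreover have "2 * (K * norm (y - x)) \<le> (norm (y - x))\<^sup>2 + K\<^sup>2"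
      using zero_le_power2[of "norm (y - x) - K"] by (simp add: power2_diff mult_ac)
    moreover have "c - K * norm (y - y0) \<le> b" using spec[OF K(2), of y] that by simp
    ultimately show ?thesis by linarith
  qed
  have bdd: "bdd_below S"
    by (rule bdd_belowI[of _ "c - K * norm (x - y0) - K\<^sup>2 / 2"]) (auto simp: S_def intro: below)
  obtain w where w: "w \<in> effective_domain h" using h(1) by (auto simp: proper_def)
  obtain d where "h w = ereal d" using proper_finite_value[OF h(1) w] .
  then have "S \<noteq> {}" by (auto simp: S_def)
  define m where "m = Inf S"
  have m: "m \<le> b + (norm (y - x))\<^sup>2 / 2" if "h y = ereal b" for y b
    unfolding m_def by (rule cInf_lower[OF _ bdd]) (use that in \<open>auto simp: S_def\<close>)
  have "\<exists>y b. h y = ereal b \<and> b + (norm (y - x))\<^sup>2 / 2 < m + 1 / real (Suc n)" for n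
    using cInf_lessD[OF \<open>S \<noteq> {}\<close>, of "m + 1 / real (Suc n)"] by (auto simp: S_def m_def)
  then obtain y b where y: "\<And>n. h (y n) = ereal (b n)"
    and near: "\<And>n. b n + (norm (y n - x))\<^sup>2 / 2 < m + 1 / real (Suc n)"
    by metis
  have "Cauchy y"
  proof (rule CauchyI)
    fix e :: real assume "0 < e"
    \<comment> \<open>Two excesses over \<open>m\<close>, each below \<open>e\<^sup>2 / 8\<close>, enter with the factor 4.\<close>
    then obtain N where N: "1 / real (Suc N) < e\<^sup>2 / 8"
      using nat_approx_posE[of "e\<^sup>2 / 8"] by auto
    have "norm (y i - y j) < e" if "N \<le> i" "N \<le> j" for i j
    proof -
      have "b k + (norm (y k - x))\<^sup>2 / 2 < m + e\<^sup>2 / 8" if "N \<le> k" for k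
      proof -
        have "1 / real (Suc k) \<le> 1 / real (Suc N)" using that by (intro frac_le) auto
        then show ?thesis using near[of k] N by argo
      qed
      note this[OF \<open>N \<le> i\<close>] this[OF \<open>N \<le> j\<close>]
      moreover have "(norm (y i - y j))\<^sup>2 \<le>
          4 * ((b i + (norm (y i - x))\<^sup>2 / 2 - m) + (b j + (norm (y j - x))\<^sup>2 / 2 - m))"
        by (rule midpoint_gap[OF h(3,1) _ y y]) (rule m)
      ultimately have "(norm (y i - y j))\<^sup>2 < e\<^sup>2" by argo
      then show ?thesis using \<open>0 < e\<close> by (simp add: power2_less_imp_less)
    qed
    then show "\<exists>M. \<forall>i\<ge>M. \<forall>j\<ge>M. norm (y i - y j) < e" by blast
  qed
  then obtain p where p: "y \<longlonglongrightarrow> p" by (auto simp: Cauchy_convergent_iff convergent_def)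
  have "(\<lambda>n. m + 1 / real (Suc n) - (norm (y n - x))\<^sup>2 / 2) \<longlonglongrightarrow> m + 0 - (norm (p - x))\<^sup>2 / 2"
    by (intro tendsto_intros p LIMSEQ_Suc lim_1_over_n) simp
  from lower_semicontinuous_limit_le[OF h(2) p this]
  have hp: "h p \<le> ereal (m - (norm (p - x))\<^sup>2 / 2)"
    using near by (simp add: y algebra_simps less_imp_le)
  then obtain a where a: "h p = ereal a"
    using h(1) by (cases "h p") (auto simp: proper_def)
  show thesis
  proof (rule that[OF a])
    fix z d assume "h z = ereal d"
    from m[OF this] hp a show "a + (norm (p - x))\<^sup>2 / 2 \<le> d + (norm (z - x))\<^sup>2 / 2" by simp
  qed
qed

text \<open>
  Moving from \<open>p\<close> a fraction \<open>t\<close> of the way to \<open>z\<close> changes the quadratic term by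
  \<open>t * ((p - x) \<bullet> (z - p))\<close> up to order \<open>t\<^sup>2\<close>, and increases \<open>h\<close> by at most \<open>t * (h z - h p)\<close>.
  Minimality, divided by \<open>t\<close>, becomes the subgradient inequality as \<open>t\<close> tends to 0.
\<close>

lemma minimizer_imp_prox_inclusion:
  fixes h :: "'a::real_inner \<Rightarrow> ereal"
  assumes "ereal_convex h" and "proper h" and a: "h p = ereal a"
    and min: "\<And>y b. h y = ereal b \<Longrightarrow> a + (norm (p - x))\<^sup>2 / 2 \<le> b + (norm (y - x))\<^sup>2 / 2"
  shows "x - p \<in> subdifferential h p"
  unfolding subdifferential_def
proof (intro CollectI allI)
  fix z
  show "ereal ((x - p) \<bullet> (z - p)) \<le> h z - h p"
  proof (cases "h z")
    case (real b)
    have step: "(x - p) \<bullet> (z - p) \<le> b - a + t * ((norm (z - p))\<^sup>2 / 2)" if t: "0 < t" "t < 1" for t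
    proof -
      let ?w = "(1 - t) *\<^sub>R p + t *\<^sub>R z"
      obtain c where c: "h ?w = ereal c" "c \<le> (1 - t) * a + t * b"
        using ereal_convex_finite_values[OF assms(1,2) a real t] .
      have w: "?w - x = (p - x) + t *\<^sub>R (z - p)" by (simp add: algebra_simps)
      have "(norm (?w - x))\<^sup>2
          = (norm (p - x))\<^sup>2 - 2 * t * ((x - p) \<bullet> (z - p)) + t\<^sup>2 * (norm (z - p))\<^sup>2"
        unfolding w power2_norm_eq_inner
        by (simp add: inner_simps algebra_simps inner_commute power2_eq_square)
      with min[OF c(1)] c(2)
      have "t * ((x - p) \<bullet> (z - p)) \<le> t * (b - a + t * ((norm (z - p))\<^sup>2 / 2))"
        by (simp add: algebra_simps power2_eq_square)
      with t show ?thesis by simp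
    qed
    have "((\<lambda>t. b - a + t * ((norm (z - p))\<^sup>2 / 2)) \<longlongrightarrow> b - a + 0 * ((norm (z - p))\<^sup>2 / 2))
        (at_right 0)"
      by (intro tendsto_intros)
    moreover have "\<forall>\<^sub>F t in at_right 0. (x - p) \<bullet> (z - p) \<le> b - a + t * ((norm (z - p))\<^sup>2 / 2)"
      using step by (auto simp: eventually_at_right_field intro: exI[of _ 1])
    ultimately have "(x - p) \<bullet> (z - p) \<le> b - a + 0 * ((norm (z - p))\<^sup>2 / 2)"
      by (rule tendsto_lowerbound) simp
    then show ?thesis using real a by simp
  qed (use a assms(2) in \<open>auto simp: proper_def\<close>)
qed

section \<open>Moreau's theorem and the decomposition formula\<close>

lemma subdifferential_nonempty_imp_finite:
  assumes "proper h" and "u \<in> subdifferential h p"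
  obtains a where "h p = ereal a"
proof -
  obtain z where z: "z \<in> effective_domain h" using assms(1) by (auto simp: proper_def)
  obtain b where b: "h z = ereal b" using proper_finite_value[OF assms(1) z] .
  have "ereal (u \<bullet> (z - p)) \<le> h z - h p" using assms(2) by (simp add: subdifferential_def)
  with b assms(1) that show thesis by (cases "h p") (auto simp: proper_def)
qed

text \<open>
  Adding the two subgradient inequalities between \<open>p\<close> and \<open>q\<close> cancels the values of \<open>h\<close>
  and leaves \<open>\<parallel>q - p\<parallel>\<^sup>2 \<le> 0\<close>.
\<close>

lemma prox_inclusion_unique:
  assumes "proper h" and p: "x - p \<in> subdifferential h p" and q: "x - q \<in> subdifferential h q"
  shows "p = q"
proof -
  obtain a where a: "h p = ereal a" using subdifferential_nonempty_imp_finite[OF assms(1) p] .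
  obtain b where b: "h q = ereal b" using subdifferential_nonempty_imp_finite[OF assms(1) q] .
  have "ereal ((x - p) \<bullet> (q - p)) \<le> h q - h p" "ereal ((x - q) \<bullet> (p - q)) \<le> h p - h q"
    using p q by (auto simp: subdifferential_def)
  then have "(x - p) \<bullet> (q - p) + (x - q) \<bullet> (p - q) \<le> 0" by (simp add: a b)
  moreover have "(x - p) \<bullet> (q - p) + (x - q) \<bullet> (p - q) = (q - p) \<bullet> (q - p)"
    by (simp add: inner_simps algebra_simps inner_commute)
  ultimately have "(q - p) \<bullet> (q - p) \<le> 0" by simp
  then have "(q - p) \<bullet> (q - p) = 0" using inner_ge_zero[of "q - p"] by linarith
  then show ?thesis by simp
qed

text \<open>
  Moreau's theorem. It justifies the definite description in the definition of
  \<^const>\<open>prox\<close> and reduces statements about proximal points to subgradient inclusions.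
\<close>

lemma prox_eq_iff:
  assumes "h \<in> Gamma0"
  shows "prox h x = p \<longleftrightarrow> x - p \<in> subdifferential h p"
proof -
  have h: "proper h" "ereal_convex h" using assms by (auto simp: Gamma0_def)
  have mem: "q \<in> setmap_inverse (\<lambda>y. {y} + subdifferential h y) x
      \<longleftrightarrow> x - q \<in> subdifferential h q" for q
    by (force simp: setmap_inverse_def set_plus_def)
  obtain q where q: "x - q \<in> subdifferential h q"
    using prox_objective_attains_minimum[OF assms, of x] minimizer_imp_prox_inclusion[OF h(2,1)]
    by metis
  have "prox h x = q"
    unfolding prox_def mem using q prox_inclusion_unique[OF h(1)] by blast
  with q prox_inclusion_unique[OF h(1)] show ?thesis by blast
qed

theorem theorem2p8:
  fixes f g :: "'a::{real_inner, complete_space} \<Rightarrow> ereal"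
  assumes "f \<in> Gamma0" and "g \<in> Gamma0"
    and "effective_domain f \<inter> effective_domain g \<noteq> {}"
    and "subdifferential (\<lambda>x. f x + g x) = (\<lambda>x. subdifferential f x + subdifferential g x)"
  shows "setmap_of (prox (\<lambda>x. f x + g x)) = setmap_comp (setmap_of (prox f)) (f_prox f g)
    \<and> (\<forall>x. \<forall>z \<in> f_prox f g x. prox (\<lambda>x. f x + g x) x = prox f z)"
proof -
  have sum: "(\<lambda>x. f x + g x) \<in> Gamma0" using Gamma0_add[OF assms(1-3)] .
  have eq: "prox (\<lambda>x. f x + g x) x = prox f z" if z: "z \<in> f_prox f g x" for x z
  proof -
    have "z - prox f z \<in> subdifferential f (prox f z)"
      using prox_eq_iff[OF assms(1)] by blast
    moreover have "x - z \<in> subdifferential g (prox f z)" using z by (simp add: mem_f_prox_iff)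
    ultimately have "(z - prox f z) + (x - z) \<in> subdifferential (\<lambda>x. f x + g x) (prox f z)"
      unfolding assms(4) by (rule set_plus_intro)
    then show ?thesis using prox_eq_iff[OF sum] by simp
  qed
  have ex: "\<exists>z. z \<in> f_prox f g x" for x
  proof -
    define p where "p = prox (\<lambda>x. f x + g x) x"
    have "x - p \<in> subdifferential f p + subdifferential g p"
      using prox_eq_iff[OF sum, of x p] by (simp add: p_def assms(4))
    then obtain u v where uv: "x - p = u + v" "u \<in> subdifferential f p" "v \<in> subdifferential g p"
      by (rule set_plus_elim)
    have "prox f (p + u) = p" using prox_eq_iff[OF assms(1)] uv(2) by simp
    moreover have "x - (p + u) = v" using uv(1) by (simp add: algebra_simps)
    ultimately have "p + u \<in> f_prox f g x" using uv(3) by (simp add: mem_f_prox_iff)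
    then show ?thesis ..
  qed
  have "setmap_of (prox (\<lambda>x. f x + g x)) x = setmap_comp (setmap_of (prox f)) (f_prox f g) x" for x
    using eq ex[of x] by (auto simp: setmap_of_def setmap_comp_def simp flip: eq)
  with eq show ?thesis by blast
qed

end
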